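(* Let $\{x_n\}_{n\ge1}$ be i.i.d. random variables uniformly distributed on $[-1,1]$. For every $0<\alpha<1$ there exists an increasing (in the weak sense, i.e. non-decreasing) odd function $f:[-1,1]\to[-1,1]$ which is Hölder continuous with exponent $\alpha$ and maps onto $[-1,1]$, such that $S_n=\sum_{j=1}^nf(x_j)$ does not admit the Edgeworth expansion of any (integer) order $r>\frac{1+\alpha}{1-\alpha}$.
   Context: Let $\sigma_n=\sqrt{\mathrm{Var}(S_n)}$ and $\hat S_n=(S_n-\mathbb E[S_n])/\sigma_n$. $S_n$ admits the Edgeworth expansion of order $r$ (integer $r\ge1$) if there are polynomials $P_{1,n},\dots,P_{r,n}$ with degrees not depending on $n$ and coefficients uniformly bounded in $n$ such that $\sup_{t\in\mathbb R}\big|\mathbb P(\hat S_n\le t)-\Phi(t)-\sum_{j=1}^r\sigma_n^{-j}P_{j,n}(t)\phi(t)\big|=o(\sigma_n^{-r})$ as $n\to\infty$, where $\Phi$ and $\phi(t)=\frac1{\sqrt{2\pi}}e^{-t^2/2}$ are the standard normal distribution function and density. *)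

theory Defs
  imports "HOL-Probability.Probability" "HOL-Computational_Algebra.Polynomial"
    "HOL-Library.Landau_Symbols"
begin

definition holder_on :: "real \<Rightarrow> real set \<Rightarrow> (real \<Rightarrow> real) \<Rightarrow> bool" where
  "holder_on \<alpha> A f \<longleftrightarrow>
     (\<exists>C. \<forall>x\<in>A. \<forall>y\<in>A. \<bar>f x - f y\<bar> \<le> C * \<bar>x - y\<bar> powr \<alpha>)"

definition std_dev :: "'a measure \<Rightarrow> ('a \<Rightarrow> real) \<Rightarrow> real" where
  "std_dev M Y = sqrt (prob_space.variance M Y)"

definition standardized :: "'a measure \<Rightarrow> ('a \<Rightarrow> real) \<Rightarrow> 'a \<Rightarrow> real" where
  "standardized M Y \<omega> = (Y \<omega> - prob_space.expectation M Y) / std_dev M Y"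

text \<open>
  That the degrees do not depend on \<open>n\<close> is read as a bound \<open>d j\<close> on the degree of \<open>P j n\<close>,
  uniform in \<open>n\<close>. Asking for \<open>degree (P j n) = d j\<close> gives the same notion: adding to
  \<open>P j n\<close> a term of degree \<open>d j + 1\<close> whose nonzero coefficient tends to zero fast enough
  as \<open>n\<close> grows does not affect the asymptotics.
  The supremum is over a bounded set, since a polynomial times the normal density is bounded.
\<close>

definition admits_edgeworth_expansion ::
    "'a measure \<Rightarrow> (nat \<Rightarrow> 'a \<Rightarrow> real) \<Rightarrow> nat \<Rightarrow> bool" where
  "admits_edgeworth_expansion M S r \<longleftrightarrow>
     (\<exists>P :: nat \<Rightarrow> nat \<Rightarrow> real poly.
        (\<exists>d. \<forall>j\<in>{1..r}. \<forall>n\<ge>1. degree (P j n) \<le> d j) \<and>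
        (\<exists>C. \<forall>j\<in>{1..r}. \<forall>n\<ge>1. \<forall>k. \<bar>coeff (P j n) k\<bar> \<le> C) \<and>
        (\<lambda>n. SUP t. \<bar>measure M {\<omega> \<in> space M. standardized M (S n) \<omega> \<le> t}
                     - cdf std_normal_distribution t
                     - (\<Sum>j=1..r. (1 / std_dev M (S n) ^ j) * poly (P j n) t
                                    * std_normal_density t)\<bar>)
          \<in> o(\<lambda>n. 1 / std_dev M (S n) ^ r))"

end

theory Submission imports Defs begin

text \<open>
  Take \<open>f\<close> to be the Cantor function of the self-similar Cantor set in \<open>[-1, 1]\<close> with contraction
  ratio \<open>\<rho> = 2 powr (- 1 / \<alpha>)\<close>, so that the set has dimension \<open>\<alpha>\<close> and \<open>f\<close> is \<open>\<alpha>\<close>-Hoelder.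
  Outside a set of probability at most \<open>(2\<rho>)^k\<close> the values of \<open>f\<close> lie in the lattice of mesh
  \<open>2^-k\<close>. If \<open>n\<close> is about \<open>(2\<rho>)^-k / 2\<close>, then with probability at least \<open>1/4\<close> the sum \<open>S n\<close> is a
  lattice point within \<open>2 sqrt n\<close> of its mean, and by the pigeonhole principle \<open>S n\<close> has an atom of
  mass of order at least \<open>1 / (sqrt n * 2^k)\<close>, which is \<open>n powr (- (1 + \<alpha>) / (2 * (1 - \<alpha>)))\<close>. An
  Edgeworth approximation is continuous in \<open>t\<close>, so its uniform error is at least half of any atom,
  while an expansion of order \<open>r\<close> makes that error \<open>o(n powr (- r / 2))\<close>.
\<close>

subsection \<open>The Cantor function\<close>

text \<open>
  Since every approximant is constant outside \<open>[-1, 1]\<close>, averaging the two rescaled copies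
  reproduces the usual definition by three cases: at most one of the copies varies at any point.
\<close>

primrec cantor_iter :: "real \<Rightarrow> nat \<Rightarrow> real \<Rightarrow> real" where
  "cantor_iter \<rho> 0 x = max (-1) (min 1 x)"
| "cantor_iter \<rho> (Suc k) x =
     (cantor_iter \<rho> k ((x - (1 - \<rho>)) / \<rho>) + cantor_iter \<rho> k ((x + (1 - \<rho>)) / \<rho>)) / 2"

definition cantor_fun :: "real \<Rightarrow> real \<Rightarrow> real" where
  "cantor_fun \<rho> x = lim (\<lambda>k. cantor_iter \<rho> k x)"

section \<open>Approximants: monotonicity, symmetry, geometric convergence\<close>

lemma cantor_iter_mono:
  assumes "0 < \<rho>" "x \<le> y"
  shows "cantor_iter \<rho> k x \<le> cantor_iter \<rho> k y"
  using assms(2)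
proof (induction k arbitrary: x y)
  case (Suc k)
  have "cantor_iter \<rho> k ((x - (1 - \<rho>)) / \<rho>) \<le> cantor_iter \<rho> k ((y - (1 - \<rho>)) / \<rho>)"
       "cantor_iter \<rho> k ((x + (1 - \<rho>)) / \<rho>) \<le> cantor_iter \<rho> k ((y + (1 - \<rho>)) / \<rho>)"
    using Suc assms(1) by (auto intro!: Suc.IH divide_right_mono)
  then show ?case by simp
qed auto

text \<open>Reflection in 0 exchanges the two affine branches.\<close>

lemma cantor_iter_minus: "cantor_iter \<rho> k (- x) = - cantor_iter \<rho> k x"
proof (induction k arbitrary: x)
  case (Suc k)
  have "(- x - (1 - \<rho>)) / \<rho> = - ((x + (1 - \<rho>)) / \<rho>)" "(- x + (1 - \<rho>)) / \<rho> = - ((x - (1 - \<rho>)) / \<rho>)"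
    by (simp_all add: minus_divide_left)
  moreover have "(- b + - a) / 2 = - ((a + b) / 2)" for a b :: real by (simp add: field_simps)
  ultimately show ?case by (simp only: cantor_iter.simps Suc.IH)
qed (auto simp: max_def min_def)

lemma cantor_iter_eq_1:
  assumes "0 < \<rho>" "\<rho> < 1/2" "1 \<le> x"
  shows "cantor_iter \<rho> k x = 1"
  using assms(3)
proof (induction k arbitrary: x)
  case (Suc k)
  have "1 \<le> (x - (1 - \<rho>)) / \<rho>" "1 \<le> (x + (1 - \<rho>)) / \<rho>"
    using Suc.prems assms(1,2) by (auto simp: field_simps)
  then show ?case using Suc.IH by simp
qed auto

lemma cantor_iter_eq_minus_1:
  assumes "0 < \<rho>" "\<rho> < 1/2" "x \<le> -1"
  shows "cantor_iter \<rho> k x = -1"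
  using cantor_iter_eq_1[of \<rho> "-x" k] cantor_iter_minus[of \<rho> k x] assms by simp

text \<open>The rescaled copies are constant once their arguments leave [-1, 1]. As \<rho> < 1/2,
  the two ranges of \<open>x\<close> overlap in the middle gap and cover the line, so at every point
  at least one copy is constant.\<close>

lemma affine_branches:
  fixes \<rho> x y :: real
  assumes "0 < \<rho>"
  shows "x \<le> 1 - 2 * \<rho> \<Longrightarrow> (x - (1 - \<rho>)) / \<rho> \<le> -1" "-(1 - 2 * \<rho>) \<le> x \<Longrightarrow> 1 \<le> (x + (1 - \<rho>)) / \<rho>"
  using assms by (auto simp: field_simps)

text \<open>The increment at level \<open>Suc k\<close> is the average of two rescaled increments at
  level \<open>k\<close>, one of which vanishes; so the bound is halved at each level.\<close>

lemma cantor_iter_step: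
  assumes "0 < \<rho>" "\<rho> < 1/2"
  shows "\<bar>cantor_iter \<rho> (Suc k) x - cantor_iter \<rho> k x\<bar> \<le> 2 * (1/2) ^ k"
proof (induction k arbitrary: x)
  case 0
  have *: "\<bar>(a + b) / 2 - c\<bar> \<le> 2" if "\<bar>a\<bar> \<le> 1" "\<bar>b\<bar> \<le> 1" "\<bar>c\<bar> \<le> 1" for a b c :: real
    using that unfolding add_divide_distrib by linarith
  have le: "\<bar>cantor_iter \<rho> 0 u\<bar> \<le> 1" for u by auto
  have "\<bar>cantor_iter \<rho> (Suc 0) x - cantor_iter \<rho> 0 x\<bar> \<le> 2"
    unfolding cantor_iter.simps(2) by (intro * le)
  then show ?case by (simp only: power_0 mult_1_right)
next
  case (Suc k)
  let ?d = "\<lambda>u. cantor_iter \<rho> (Suc k) u - cantor_iter \<rho> k u"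
  let ?u = "(x - (1 - \<rho>)) / \<rho>" and ?v = "(x + (1 - \<rho>)) / \<rho>"
  have "?d ?u = 0 \<or> ?d ?v = 0"
  proof (cases "x \<le> 1 - 2 * \<rho>")
    case True
    then have "?u \<le> -1" using affine_branches assms by simp
    then show ?thesis by (simp only: cantor_iter_eq_minus_1[OF assms] diff_self simp_thms)
  next
    case False
    then have "1 \<le> ?v" using affine_branches[of \<rho> x] assms by simp
    then show ?thesis by (simp only: cantor_iter_eq_1[OF assms] diff_self simp_thms)
  qed
  moreover have "cantor_iter \<rho> (Suc (Suc k)) x - cantor_iter \<rho> (Suc k) x = (?d ?u + ?d ?v) / 2"
    unfolding cantor_iter.simps(2)[of \<rho> "Suc k" x] cantor_iter.simps(2)[of \<rho> k x]
    by (simp only: diff_divide_distrib[symmetric] add_diff_add)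
  moreover have "\<bar>(a + b) / 2\<bar> \<le> 2 * (1/2) ^ Suc k"
    if "a = 0 \<or> b = 0" "\<bar>a\<bar> \<le> 2 * (1/2) ^ k" "\<bar>b\<bar> \<le> 2 * (1/2) ^ k" for a b :: real
    using that by auto
  ultimately show ?case using Suc.IH by (simp only:)
qed

lemma cantor_iter_tendsto:
  assumes "0 < \<rho>" "\<rho> < 1/2"
  shows "(\<lambda>k. cantor_iter \<rho> k x) \<longlonglongrightarrow> cantor_fun \<rho> x"
proof -
  have "summable (\<lambda>k. cantor_iter \<rho> (Suc k) x - cantor_iter \<rho> k x)"
  proof (rule summable_comparison_test')
    show "summable (\<lambda>k. 2 * (1/2) ^ k :: real)" by (intro summable_mult summable_geometric) simp
  qed (use cantor_iter_step[OF assms] in auto)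
  then have "convergent (\<lambda>n. \<Sum>k<n. cantor_iter \<rho> (Suc k) x - cantor_iter \<rho> k x)"
    by (simp only: summable_iff_convergent)
  also have "(\<lambda>n. \<Sum>k<n. cantor_iter \<rho> (Suc k) x - cantor_iter \<rho> k x) =
      (\<lambda>n. cantor_iter \<rho> n x - cantor_iter \<rho> 0 x)"
    by (rule ext) (rule sum_lessThan_telescope)
  finally have "convergent (\<lambda>k. cantor_iter \<rho> k x)"
    using convergent_diff_const_right_iff by fast
  then show ?thesis unfolding cantor_fun_def by (simp only: convergent_LIMSEQ_iff)
qed

section \<open>The limit function: self-similarity, oscillation, Hoelder bound, exceptional
  set\<close>

context
  fixes \<rho> :: real
  assumes \<rho>: "0 < \<rho>" "\<rho> < 1/2"
begin

lemma cantor_fun_mono: "x \<le> y \<Longrightarrow> cantor_fun \<rho> x \<le> cantor_fun \<rho> y"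
  by (rule LIMSEQ_le[OF cantor_iter_tendsto cantor_iter_tendsto]) (use \<rho> cantor_iter_mono in auto)

lemma cantor_fun_minus: "cantor_fun \<rho> (- x) = - cantor_fun \<rho> x"
  by (rule LIMSEQ_unique[OF cantor_iter_tendsto[OF \<rho>, of "-x"]])
    (use tendsto_minus[OF cantor_iter_tendsto[OF \<rho>, of x]] in \<open>simp add: cantor_iter_minus\<close>)

lemma cantor_fun_eq_1: "1 \<le> x \<Longrightarrow> cantor_fun \<rho> x = 1"
  by (rule LIMSEQ_unique[OF cantor_iter_tendsto[OF \<rho>, of x]]) (simp add: cantor_iter_eq_1[OF \<rho>])

lemma cantor_fun_eq_minus_1: "x \<le> -1 \<Longrightarrow> cantor_fun \<rho> x = -1"
  using cantor_fun_eq_1[of "-x"] cantor_fun_minus[of x] by simp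

text \<open>The self-similarity, obtained by passing to the limit in the recursion; the estimates
  below unfold one level of it at a time.\<close>

lemma cantor_fun_eq:
  "cantor_fun \<rho> x = (cantor_fun \<rho> ((x - (1 - \<rho>)) / \<rho>) + cantor_fun \<rho> ((x + (1 - \<rho>)) / \<rho>)) / 2"
proof (rule LIMSEQ_unique)
  show "(\<lambda>k. cantor_iter \<rho> (Suc k) x) \<longlonglongrightarrow> cantor_fun \<rho> x"
    using cantor_iter_tendsto[OF \<rho>, of x] by (rule LIMSEQ_Suc)
  show "(\<lambda>k. cantor_iter \<rho> (Suc k) x) \<longlonglongrightarrow>
    (cantor_fun \<rho> ((x - (1 - \<rho>)) / \<rho>) + cantor_fun \<rho> ((x + (1 - \<rho>)) / \<rho>)) / 2"
    unfolding cantor_iter.simps by (intro tendsto_intros cantor_iter_tendsto \<rho>) simp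
qed

lemma abs_cantor_fun_le: "\<bar>cantor_fun \<rho> x\<bar> \<le> 1"
proof -
  have "cantor_fun \<rho> x \<le> cantor_fun \<rho> (max x 1)" "cantor_fun \<rho> (min x (-1)) \<le> cantor_fun \<rho> x"
    by (auto intro: cantor_fun_mono)
  then show ?thesis using cantor_fun_eq_1[of "max x 1"] cantor_fun_eq_minus_1[of "min x (-1)"] by auto
qed

text \<open>The point \<open>1 - \<rho>\<close> is the midpoint of the right first-level interval
  \<open>[1 - 2 * \<rho>, 1]\<close>: beyond it one copy is at least 0 and the other equals 1. This
  serves to bound the variance from below.\<close>

lemma cantor_fun_ge_half: "1 - \<rho> \<le> x \<Longrightarrow> 1/2 \<le> cantor_fun \<rho> x"
proof -
  assume x: "1 - \<rho> \<le> x"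
  have "cantor_fun \<rho> 0 = 0" using cantor_fun_minus[of 0] by simp
  then have "0 \<le> cantor_fun \<rho> ((x - (1 - \<rho>)) / \<rho>)"
    using cantor_fun_mono[of 0 "(x - (1 - \<rho>)) / \<rho>"] x \<rho> by simp
  moreover have "cantor_fun \<rho> ((x + (1 - \<rho>)) / \<rho>) = 1"
    using x \<rho> by (intro cantor_fun_eq_1 affine_branches) auto
  ultimately show ?thesis using cantor_fun_eq[of x] by simp
qed

text \<open>The middle gap has width \<open>2 * (1 - 2 * \<rho>)\<close>. Points no further apart
  than this share a constant copy, so one level of self-similarity halves the oscillation while
  stretching the distance by \<open>1 / \<rho>\<close>.\<close>

lemma cantor_fun_oscillation:
  "\<bar>x - y\<bar> \<le> 2 * (1 - 2 * \<rho>) * \<rho> ^ k \<Longrightarrow> \<bar>cantor_fun \<rho> x - cantor_fun \<rho> y\<bar> \<le> 2 * (1/2) ^ k"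
proof (induction k arbitrary: x y)
  case 0
  show ?case using abs_cantor_fun_le[of x] abs_cantor_fun_le[of y] by simp
next
  case (Suc k)
  let ?l = "\<lambda>x. (x - (1 - \<rho>)) / \<rho>" and ?r = "\<lambda>x. (x + (1 - \<rho>)) / \<rho>"
  let ?dl = "cantor_fun \<rho> (?l x) - cantor_fun \<rho> (?l y)"
  let ?dr = "cantor_fun \<rho> (?r x) - cantor_fun \<rho> (?r y)"
  have *: "\<bar>x - y\<bar> / \<rho> \<le> 2 * (1 - 2 * \<rho>) * \<rho> ^ k"
    using Suc.prems \<rho> by (simp add: field_simps)
  have "?l x - ?l y = (x - y) / \<rho>" "?r x - ?r y = (x - y) / \<rho>"
    by (simp_all add: diff_divide_distrib[symmetric])
  then have IH: "\<bar>?dl\<bar> \<le> 2 * (1/2) ^ k" "\<bar>?dr\<bar> \<le> 2 * (1/2) ^ k"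
    using * \<rho> by (auto intro!: Suc.IH)
  have "\<rho> ^ Suc k \<le> 1" using \<rho> by (intro power_le_one) auto
  then have "2 * (1 - 2 * \<rho>) * \<rho> ^ Suc k \<le> 2 * (1 - 2 * \<rho>) * 1"
    using \<rho> by (intro mult_left_mono) auto
  then have le: "\<bar>x - y\<bar> \<le> 2 * (1 - 2 * \<rho>)" using Suc.prems by simp
  \<comment> \<open>If one point exceeds the right end of the gap, the distance bound keeps both to
    the right of its left end.\<close>
  have "?dl = 0 \<or> ?dr = 0"
  proof (cases "max x y \<le> 1 - 2 * \<rho>")
    case True
    then have "?l x \<le> -1" "?l y \<le> -1" using affine_branches(1)[OF \<rho>(1)] by auto
    then show ?thesis using cantor_fun_eq_minus_1 by simp
  next
    case False
    then have "- (1 - 2 * \<rho>) \<le> x" "- (1 - 2 * \<rho>) \<le> y" using le by auto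
    then have "1 \<le> ?r x" "1 \<le> ?r y" using affine_branches(2)[OF \<rho>(1)] by auto
    then show ?thesis using cantor_fun_eq_1 by simp
  qed
  then show ?case using IH cantor_fun_eq[of x] cantor_fun_eq[of y] by auto
qed

lemma cantor_fun_holder:
  assumes "\<rho> powr \<alpha> = 1/2"
  shows "\<bar>cantor_fun \<rho> x - cantor_fun \<rho> y\<bar> \<le> 4 / (2 * (1 - 2 * \<rho>)) powr \<alpha> * \<bar>x - y\<bar> powr \<alpha>"
proof -
  define g where "g = 2 * (1 - 2 * \<rho>)"
  have g: "g > 0" using \<rho> by (simp add: g_def)
  \<comment> \<open>A nonpositive exponent would make \<open>\<rho> powr \<alpha>\<close> at least
    1.\<close>
  have "\<alpha> > 0"
  proof (rule ccontr)
    assume "\<not> \<alpha> > 0"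
    then have "\<rho> powr \<alpha> \<ge> \<rho> powr 0" using \<rho> by (intro powr_mono') auto
    then show False using assms \<rho> by simp
  qed
  have pw: "(\<rho> ^ k) powr \<alpha> = (1/2) ^ k" for k
  proof -
    have "(\<rho> ^ k) powr \<alpha> = (\<rho> powr \<alpha>) ^ k"
      using \<rho> by (simp add: powr_realpow[symmetric] powr_powr mult.commute)
    then show ?thesis using assms by simp
  qed
  show ?thesis
  proof (cases "x = y")
    case False
    define s where "s = \<bar>x - y\<bar> / g"
    have s: "s > 0" using False g by (simp add: s_def)
    have "(\<lambda>k. \<rho> ^ k) \<longlonglongrightarrow> 0" using \<rho> by (intro LIMSEQ_realpow_zero) auto
    then have "eventually (\<lambda>k. \<rho> ^ k < s) sequentially" using s by (rule order_tendstoD)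
    then have ex: "\<exists>k. \<rho> ^ k < s" by (auto simp: eventually_sequentially)
    define m where "m = (LEAST k. \<rho> ^ k < s)"
    have m: "\<rho> ^ m < s" unfolding m_def using ex by (rule LeastI_ex)
    \<comment> \<open>By minimality of \<open>m\<close> the oscillation bound applies at level
      \<open>m - 1\<close>, whence the factor 4 instead of 2; for \<open>m = 0\<close> the range of
      the function suffices.\<close>
    have "\<bar>cantor_fun \<rho> x - cantor_fun \<rho> y\<bar> \<le> 4 * (1/2) ^ m"
    proof (cases m)
      case 0
      then show ?thesis using abs_cantor_fun_le[of x] abs_cantor_fun_le[of y] by simp
    next
      case (Suc k)
      then have "k < (LEAST k. \<rho> ^ k < s)" by (simp add: m_def)
      then have "\<not> \<rho> ^ k < s" by (rule not_less_Least)
      then have "\<bar>x - y\<bar> \<le> g * \<rho> ^ k" using g by (simp add: s_def field_simps)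
      then show ?thesis using cantor_fun_oscillation[of x y k] Suc by (simp add: g_def)
    qed
    also have "\<dots> = 4 * (\<rho> ^ m) powr \<alpha>" by (simp add: pw)
    also have "\<dots> \<le> 4 * s powr \<alpha>"
      using m \<rho> \<open>\<alpha> > 0\<close> by (intro mult_left_mono powr_mono2) auto
    also have "\<dots> = 4 / g powr \<alpha> * \<bar>x - y\<bar> powr \<alpha>"
      using g by (simp add: s_def powr_divide)
    finally show ?thesis by (simp add: g_def)
  qed simp
qed

text \<open>Off the level-\<open>k\<close> intervals of the Cantor construction the function is
  constant with a value in the lattice of mesh \<open>2^-k\<close>. Those intervals number at most
  \<open>2^k\<close> and have half-length \<open>\<rho>^k\<close>.\<close>

lemma cantor_fun_nonlattice_cover:
  "\<exists>C. finite C \<and> card C \<le> 2 ^ k \<and>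
     {x. 2 ^ k * cantor_fun \<rho> x \<notin> \<int>} \<subseteq> (\<Union>c\<in>C. {c - \<rho> ^ k..c + \<rho> ^ k})"
proof (induction k)
  case 0
  have "\<bar>x\<bar> \<le> 1" if "cantor_fun \<rho> x \<notin> \<int>" for x
  proof (rule ccontr)
    assume "\<not> \<bar>x\<bar> \<le> 1"
    then have "x \<ge> 1 \<or> x \<le> -1" by linarith
    then show False using that cantor_fun_eq_1[of x] cantor_fun_eq_minus_1[of x] by auto
  qed
  then have "{x. 2 ^ 0 * cantor_fun \<rho> x \<notin> \<int>} \<subseteq> (\<Union>c\<in>{0}. {c - \<rho> ^ 0..c + \<rho> ^ 0})"
    by force
  moreover have "finite {0::real}" "card {0::real} \<le> 2 ^ 0" by auto
  ultimately show ?case by blast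
next
  case (Suc k)
  then obtain C where C: "finite C" "card C \<le> 2 ^ k"
    "{x. 2 ^ k * cantor_fun \<rho> x \<notin> \<int>} \<subseteq> (\<Union>c\<in>C. {c - \<rho> ^ k..c + \<rho> ^ k})" by blast
  \<comment> \<open>The new centres are the images of the old ones under the two contractions
    inverse to the branches.\<close>
  define D where "D = (\<lambda>c. \<rho> * c + (1 - \<rho>)) ` C \<union> (\<lambda>c. \<rho> * c - (1 - \<rho>)) ` C"
  have "card D \<le> 2 ^ Suc k"
    unfolding D_def
    by (rule order.trans[OF card_Un_le])
      (use C(2) card_image_le[OF C(1), of "\<lambda>c. \<rho> * c + (1 - \<rho>)"]
         card_image_le[OF C(1), of "\<lambda>c. \<rho> * c - (1 - \<rho>)"] in simp)
  moreover have "x \<in> (\<Union>c\<in>D. {c - \<rho> ^ Suc k..c + \<rho> ^ Suc k})"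
    if x: "2 ^ Suc k * cantor_fun \<rho> x \<notin> \<int>" for x
  proof -
    let ?u = "(x - (1 - \<rho>)) / \<rho>" and ?v = "(x + (1 - \<rho>)) / \<rho>"
    have "2 ^ Suc k * cantor_fun \<rho> x = 2 ^ k * cantor_fun \<rho> ?u + 2 ^ k * cantor_fun \<rho> ?v"
      by (subst cantor_fun_eq) (simp add: algebra_simps)
    then have "2 ^ k * cantor_fun \<rho> ?u \<notin> \<int> \<or> 2 ^ k * cantor_fun \<rho> ?v \<notin> \<int>"
      using x by (metis Ints_add)
    then consider c where "c \<in> C" "?u \<in> {c - \<rho> ^ k..c + \<rho> ^ k}"
      | c where "c \<in> C" "?v \<in> {c - \<rho> ^ k..c + \<rho> ^ k}" using C(3) by blast
    then show ?thesis
    proof cases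
      case 1
      then have "x \<in> {(\<rho> * c + (1 - \<rho>)) - \<rho> ^ Suc k..(\<rho> * c + (1 - \<rho>)) + \<rho> ^ Suc k}"
        using \<rho> by (auto simp: field_simps)
      then show ?thesis using 1(1) unfolding D_def by blast
    next
      case 2
      then have "x \<in> {(\<rho> * c - (1 - \<rho>)) - \<rho> ^ Suc k..(\<rho> * c - (1 - \<rho>)) + \<rho> ^ Suc k}"
        using \<rho> by (auto simp: field_simps)
      then show ?thesis using 2(1) unfolding D_def by blast
    qed
  qed
  moreover have "finite D" using C(1) by (simp add: D_def)
  ultimately show ?case by (intro exI[of _ D]) auto
qed

lemma continuous_on_cantor_fun: "continuous_on UNIV (cantor_fun \<rho>)"
proof -
  have "isCont (cantor_fun \<rho>) x" for x
    unfolding isCont_def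
  proof (rule LIM_I)
    fix e :: real assume "e > 0"
    then obtain k where k: "(1/2) ^ k < e / 2" using real_arch_pow_inv[of "e/2" "1/2"] by auto
    show "\<exists>s>0. \<forall>y. y \<noteq> x \<and> norm (y - x) < s \<longrightarrow> norm (cantor_fun \<rho> y - cantor_fun \<rho> x) < e"
    proof (intro exI[of _ "2 * (1 - 2 * \<rho>) * \<rho> ^ k"] conjI allI impI)
      fix y assume "y \<noteq> x \<and> norm (y - x) < 2 * (1 - 2 * \<rho>) * \<rho> ^ k"
      then show "norm (cantor_fun \<rho> y - cantor_fun \<rho> x) < e"
        using cantor_fun_oscillation[of y x k] k by simp
    qed (use \<rho> in simp)
  qed
  then show ?thesis by (simp add: continuous_on_eq_continuous_at)
qed

lemma cantor_fun_measurable: "cantor_fun \<rho> \<in> borel_measurable borel"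
  using continuous_on_cantor_fun by (rule borel_measurable_continuous_onI)

lemma cantor_fun_image: "cantor_fun \<rho> ` {-1..1} = {-1..1}"
proof
  show "cantor_fun \<rho> ` {-1..1} \<subseteq> {-1..1}" 
  proof
    fix y assume "y \<in> cantor_fun \<rho> ` {-1..1}"
    then show "y \<in> {-1..1}" using abs_cantor_fun_le by (fastforce simp: abs_le_iff)
  qed
  show "{-1..1} \<subseteq> cantor_fun \<rho> ` {-1..1}"
  proof
    fix y :: real assume "y \<in> {-1..1}"
    then have "\<exists>x\<ge>-1. x \<le> 1 \<and> cantor_fun \<rho> x = y"
      using cantor_fun_eq_1[of 1] cantor_fun_eq_minus_1[of "-1"] continuous_on_cantor_fun
      by (intro IVT') (auto intro: continuous_on_subset)
    then show "y \<in> cantor_fun \<rho> ` {-1..1}" by auto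
  qed
qed

end

subsection \<open>Continuity of Edgeworth approximations, variances and atoms\<close>

lemma power_le_fact_mult_exp: "u ^ k \<le> fact k * exp u" if "0 \<le> u" for u :: real
proof -
  have "(\<Sum>n\<in>{k}. u ^ n /\<^sub>R fact n) \<le> (\<Sum>n. u ^ n /\<^sub>R fact n)"
    using that by (intro sum_le_suminf summable_exp_generic) auto
  then have "u ^ k / fact k \<le> exp u" by (simp add: exp_def divide_inverse mult.commute)
  then show ?thesis by (simp add: pos_divide_le_eq mult.commute)
qed

text \<open>Ensures that the supremum in the Edgeworth error is over a bounded set. Each monomial is
  dominated by an exponential, which the Gaussian factor absorbs.\<close>

lemma bounded_poly_mult_std_normal_density:
  "\<exists>B. \<forall>t. \<bar>poly p t * std_normal_density t\<bar> \<le> B"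
proof -
  have mono: "\<bar>t\<bar> ^ k * std_normal_density t \<le> fact k * exp (1/2)" for k t
  proof -
    have "1 \<le> sqrt (2 * pi)" using pi_gt3 by simp
    then have "std_normal_density t \<le> exp (- t\<^sup>2 / 2)"
      unfolding std_normal_density_def by (intro mult_left_le_one_le) auto
    then have "\<bar>t\<bar> ^ k * std_normal_density t \<le> (fact k * exp \<bar>t\<bar>) * exp (- t\<^sup>2 / 2)"
      by (intro mult_mono power_le_fact_mult_exp) auto
    also have "\<dots> = fact k * exp (\<bar>t\<bar> - t\<^sup>2 / 2)"
      by (simp only: mult.assoc mult_exp_exp) simp
    \<comment> \<open>This is the nonnegativity of the square of
      \<open>\<bar>t\<bar> - 1\<close>.\<close>
    also have "\<bar>t\<bar> - t\<^sup>2 / 2 \<le> 1 / 2"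
      using zero_le_power2[of "\<bar>t\<bar> - 1"] by (simp add: power2_diff)
    finally show ?thesis by simp
  qed
  have "\<bar>poly p t * std_normal_density t\<bar> \<le> (\<Sum>i\<le>degree p. \<bar>coeff p i\<bar> * (fact i * exp (1/2)))" for t
  proof -
    have "\<bar>poly p t * std_normal_density t\<bar> \<le> (\<Sum>i\<le>degree p. \<bar>coeff p i * t ^ i * std_normal_density t\<bar>)"
      by (simp add: poly_altdef sum_distrib_right)
    also have "\<dots> \<le> (\<Sum>i\<le>degree p. \<bar>coeff p i\<bar> * (fact i * exp (1/2)))"
      using mono by (intro sum_mono) (auto simp: abs_mult power_abs mult.assoc intro!: mult_left_mono)
    finally show ?thesis .
  qed
  then show ?thesis by blast
qed

lemma isCont_cdf_std_normal: "isCont (cdf std_normal_distribution) t"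
proof -
  interpret N: real_distribution std_normal_distribution by (rule real_dist_normal_dist)
  have "emeasure std_normal_distribution {t} = 0"
    by (subst emeasure_density) (auto simp: nn_integral_0_iff_AE intro!: AE_mp[OF AE_lborel_singleton[of t]])
  then show ?thesis by (simp add: N.isCont_cdf measure_def)
qed

text \<open>Just to the left of \<open>a\<close> the distribution function is lower by at least the
  atom, while \<open>G\<close> barely changes; hence the errors at the two points together nearly
  reach the atom. Boundedness of \<open>G\<close> makes the real-valued \<open>SUP\<close> a genuine
  upper bound.\<close>

lemma (in prob_space) prob_eq_le_2_SUP_cdf_diff:
  fixes Y :: "'a \<Rightarrow> real" and G :: "real \<Rightarrow> real"
  assumes Y[measurable]: "random_variable borel Y" and G: "isCont G a" "\<And>t. \<bar>G t\<bar> \<le> B"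
  shows "prob {\<omega>\<in>space M. Y \<omega> = a} \<le> 2 * (SUP t. \<bar>prob {\<omega>\<in>space M. Y \<omega> \<le> t} - G t\<bar>)"
proof -
  define D where "D = (SUP t. \<bar>prob {\<omega>\<in>space M. Y \<omega> \<le> t} - G t\<bar>)"
  have "bdd_above (range (\<lambda>t. \<bar>prob {\<omega>\<in>space M. Y \<omega> \<le> t} - G t\<bar>))"
  proof (rule bdd_aboveI2)
    fix t show "\<bar>prob {\<omega>\<in>space M. Y \<omega> \<le> t} - G t\<bar> \<le> 1 + B"
      using G(2)[of t] prob_le_1[of "{\<omega>\<in>space M. Y \<omega> \<le> t}"] measure_nonneg[of M "{\<omega>\<in>space M. Y \<omega> \<le> t}"]
      by linarith
  qed
  then have D: "\<bar>prob {\<omega>\<in>space M. Y \<omega> \<le> t} - G t\<bar> \<le> D" for t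
    unfolding D_def by (intro cSUP_upper) auto
  have "prob {\<omega>\<in>space M. Y \<omega> = a} \<le> 2 * D"
  proof (rule field_le_epsilon)
    fix e :: real assume "e > 0"
    then obtain d where d: "d > 0" "\<And>s. \<bar>s - a\<bar> < d \<Longrightarrow> \<bar>G s - G a\<bar> < e"
      using G(1) unfolding continuous_at_eps_delta by (auto simp: dist_real_def)
    define s where "s = a - d / 2"
    have "prob {\<omega>\<in>space M. Y \<omega> = a} + prob {\<omega>\<in>space M. Y \<omega> \<le> s}
        = prob ({\<omega>\<in>space M. Y \<omega> = a} \<union> {\<omega>\<in>space M. Y \<omega> \<le> s})"
      using d(1) by (intro finite_measure_Union[symmetric]) (auto simp: s_def)
    also have "\<dots> \<le> prob {\<omega>\<in>space M. Y \<omega> \<le> a}"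
      using d(1) by (intro finite_measure_mono) (auto simp: s_def)
    finally show "prob {\<omega>\<in>space M. Y \<omega> = a} \<le> 2 * D + e"
      using D[of a] D[of s] d(2)[of s] d(1) by (simp add: s_def abs_le_iff abs_less_iff)
  qed
  then show ?thesis by (simp add: D_def)
qed

text \<open>Bienayme's identity. Square integrability is carried through the same induction, since
  expanding the variance of the enlarged sum requires it of the partial sum.\<close>

lemma (in prob_space) indep_vars_sum_square_integrable:
  fixes Y :: "'i \<Rightarrow> 'a \<Rightarrow> real"
  assumes "finite I" "indep_vars (\<lambda>_. borel) Y I"
    and "\<And>i. i \<in> I \<Longrightarrow> integrable M (Y i)" "\<And>i. i \<in> I \<Longrightarrow> integrable M (\<lambda>\<omega>. (Y i \<omega>)\<^sup>2)"
  shows "integrable M (\<lambda>\<omega>. (\<Sum>i\<in>I. Y i \<omega>)\<^sup>2) \<and>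
    variance (\<lambda>\<omega>. \<Sum>i\<in>I. Y i \<omega>) = (\<Sum>i\<in>I. variance (Y i))"
  using assms
proof (induction I)
  case empty
  then show ?case by simp
next
  case (insert i I)
  define S where "S = (\<lambda>\<omega>. \<Sum>i\<in>I. Y i \<omega>)"
  have "indep_vars (\<lambda>_. borel) Y I" using insert.prems(1) by (rule indep_vars_subset) auto
  then have IH: "integrable M (\<lambda>\<omega>. (S \<omega>)\<^sup>2)" "variance S = (\<Sum>i\<in>I. variance (Y i))"
    using insert.IH insert.prems by (auto simp: S_def)
  have int: "integrable M S" "integrable M (Y i)" "integrable M (\<lambda>\<omega>. (Y i \<omega>)\<^sup>2)"
    using insert.prems by (auto simp: S_def)
  have "indep_var borel (Y i) borel S"
    unfolding S_def using insert.hyps insert.prems(1) by (intro indep_vars_sum) auto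
  note prod = indep_var_lebesgue_integral[OF this int(2,1)] indep_var_integrable[OF this int(2,1)]
  have sq: "(\<lambda>\<omega>. (Y i \<omega> + S \<omega>)\<^sup>2) = (\<lambda>\<omega>. (Y i \<omega>)\<^sup>2 + 2 * (Y i \<omega> * S \<omega>) + (S \<omega>)\<^sup>2)"
    by (auto simp: power2_eq_square algebra_simps)
  have int_sq: "integrable M (\<lambda>\<omega>. (Y i \<omega> + S \<omega>)\<^sup>2)"
    unfolding sq using prod int IH by simp
  have "variance (\<lambda>\<omega>. Y i \<omega> + S \<omega>) = variance (Y i) + variance S"
  proof -
    have "expectation (\<lambda>\<omega>. (Y i \<omega> + S \<omega>)\<^sup>2) =
        expectation (\<lambda>\<omega>. (Y i \<omega>)\<^sup>2) + 2 * (expectation (Y i) * expectation S) + expectation (\<lambda>\<omega>. (S \<omega>)\<^sup>2)"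
      unfolding sq using prod int IH(1) by simp
    moreover have "expectation (\<lambda>\<omega>. Y i \<omega> + S \<omega>) = expectation (Y i) + expectation S"
      using int by simp
    ultimately show ?thesis
      using variance_eq[OF _ int_sq] variance_eq[OF int(2,3)] variance_eq[OF int(1) IH(1)] int
      by (simp add: power2_sum)
  qed
  then show ?case using insert.hyps int_sq IH by (simp add: S_def)
qed

text \<open>Pigeonhole: an interval of length \<open>2 * T\<close> contains at most
  \<open>2 * T * q + 1\<close> points of the lattice of mesh \<open>1 / q\<close>.\<close>

lemma (in prob_space) lattice_atom:
  fixes S :: "'a \<Rightarrow> real" and q :: real
  assumes S[measurable]: "random_variable borel S" and "0 < q" "0 < c" "0 \<le> T"
    and c: "c \<le> prob {\<omega>\<in>space M. q * S \<omega> \<in> \<int> \<and> \<bar>S \<omega> - \<mu>\<bar> \<le> T}"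
  shows "\<exists>a. c / (2 * T * q + 1) \<le> prob {\<omega>\<in>space M. S \<omega> = a}"
proof (rule ccontr)
  assume "\<not> ?thesis"
  then have less: "prob {\<omega>\<in>space M. S \<omega> = a} < c / (2 * T * q + 1)" for a by (auto simp: not_le)
  define J where "J = {\<lceil>q * (\<mu> - T)\<rceil>..\<lfloor>q * (\<mu> + T)\<rfloor>}"
  have "{\<omega>\<in>space M. q * S \<omega> \<in> \<int> \<and> \<bar>S \<omega> - \<mu>\<bar> \<le> T} \<subseteq> (\<Union>j\<in>J. {\<omega>\<in>space M. S \<omega> = of_int j / q})"
  proof
    fix \<omega> assume \<omega>: "\<omega> \<in> {\<omega>\<in>space M. q * S \<omega> \<in> \<int> \<and> \<bar>S \<omega> - \<mu>\<bar> \<le> T}"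
    then obtain j where j: "q * S \<omega> = of_int j" by (auto elim: Ints_cases)
    have "\<mu> - T \<le> S \<omega>" "S \<omega> \<le> \<mu> + T" using \<omega> by auto
    then have "q * (\<mu> - T) \<le> of_int j" "of_int j \<le> q * (\<mu> + T)"
      using \<open>0 < q\<close> by (auto simp: j[symmetric])
    then have "j \<in> J" by (simp add: J_def ceiling_le_iff le_floor_iff)
    moreover have "S \<omega> = of_int j / q" using j \<open>0 < q\<close> by (simp add: field_simps)
    ultimately show "\<omega> \<in> (\<Union>j\<in>J. {\<omega>\<in>space M. S \<omega> = of_int j / q})" using \<omega> by auto
  qed
  then have "c \<le> prob (\<Union>j\<in>J. {\<omega>\<in>space M. S \<omega> = of_int j / q})"
    by (intro order.trans[OF c] finite_measure_mono) (auto simp: J_def)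
  also have "\<dots> \<le> (\<Sum>j\<in>J. prob {\<omega>\<in>space M. S \<omega> = of_int j / q})"
    by (intro finite_measure_subadditive_finite) (auto simp: J_def)
  finally have le: "c \<le> (\<Sum>j\<in>J. prob {\<omega>\<in>space M. S \<omega> = of_int j / q})" .
  \<comment> \<open>Nonemptiness lets the cardinality be computed without truncation at 0 and makes
    the sum inequality below strict.\<close>
  then have "J \<noteq> {}" using \<open>0 < c\<close> by auto
  then have card: "real (card J) \<le> 2 * T * q + 1"
  proof -
    have "real (card J) = of_int (\<lfloor>q * (\<mu> + T)\<rfloor> - \<lceil>q * (\<mu> - T)\<rceil> + 1)"
      using \<open>J \<noteq> {}\<close> by (simp add: J_def)
    also have "\<dots> \<le> q * (\<mu> + T) - q * (\<mu> - T) + 1"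
      using of_int_floor_le[of "q * (\<mu> + T)"] le_of_int_ceiling[of "q * (\<mu> - T)"]
      by (simp only: of_int_add of_int_diff of_int_1)
    finally show ?thesis by (simp add: algebra_simps)
  qed
  have "(\<Sum>j\<in>J. prob {\<omega>\<in>space M. S \<omega> = of_int j / q}) < (\<Sum>j\<in>J. c / (2 * T * q + 1))"
    using \<open>J \<noteq> {}\<close> less by (intro sum_strict_mono) (auto simp: J_def)
  also have "\<dots> \<le> c"
  proof -
    have "0 < 2 * T * q + 1" using \<open>0 \<le> T\<close> \<open>0 < q\<close> by (intro add_nonneg_pos) auto
    moreover have "real (card J) * c \<le> (2 * T * q + 1) * c"
      using card \<open>0 < c\<close> by (intro mult_right_mono) auto
    ultimately show ?thesis by (simp add: pos_divide_le_eq mult.commute)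
  qed
  finally show False using le by simp
qed

lemma (in prob_space) prob_uniform_Icc_le:
  assumes "distributed M lborel X (\<lambda>x. indicator {-1..1} x / measure lborel {-1..1::real})" "u \<le> v"
  shows "prob {\<omega>\<in>space M. X \<omega> \<in> {u..v}} \<le> (v - u) / 2"
proof -
  have "emeasure M (X -` {u..v} \<inter> space M)
      = (\<integral>\<^sup>+x. ennreal (indicator {-1..1} x / measure lborel {-1..1::real}) * indicator {u..v} x \<partial>lborel)"
    using assms(1) by (rule distributed_emeasure) simp
  also have "\<dots> \<le> (\<integral>\<^sup>+x. ennreal (1/2) * indicator {u..v} x \<partial>lborel)"
    by (intro nn_integral_mono) (auto simp: indicator_def intro!: ennreal_leI)
  also have "\<dots> = ennreal ((v - u) / 2)"
  proof -
    have "ennreal (1/2) * ennreal (v - u) = ennreal (1/2 * (v - u))"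
      using assms(2) by (intro ennreal_mult[symmetric]) auto
    then show ?thesis using assms(2) by (subst nn_integral_cmult_indicator) simp_all
  qed
  finally have "prob (X -` {u..v} \<inter> space M) \<le> (v - u) / 2"
    using assms(2) by (simp add: emeasure_eq_measure)
  also have "X -` {u..v} \<inter> space M = {\<omega>\<in>space M. X \<omega> \<in> {u..v}}" by auto
  finally show ?thesis .
qed

subsection \<open>Sums of Cantor functions of uniform variables\<close>

context prob_space
begin

context
  fixes X :: "nat \<Rightarrow> 'a \<Rightarrow> real" and \<rho> :: real
  assumes indep: "indep_vars (\<lambda>_. borel) X {1..}"
    and unif: "\<And>n. n \<ge> 1 \<Longrightarrow>
      distributed M lborel (X n) (\<lambda>x. indicator {-1..1} x / measure lborel {-1..1::real})"
    and \<rho>: "0 < \<rho>" "\<rho> < 1/2"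
begin

lemma uniform_measurable: "j \<ge> 1 \<Longrightarrow> random_variable borel (X j)"
  using distributed_measurable[OF unif] by simp

lemma cantor_uniform_measurable [measurable]:
  "j \<ge> 1 \<Longrightarrow> random_variable borel (\<lambda>\<omega>. cantor_fun \<rho> (X j \<omega>))"
  using measurable_compose[OF uniform_measurable cantor_fun_measurable[OF \<rho>]] .

lemma cantor_sum_measurable [measurable]:
  "random_variable borel (\<lambda>\<omega>. \<Sum>j=1..n. cantor_fun \<rho> (X j \<omega>))"
  by (intro borel_measurable_sum) auto

lemma cantor_uniform_integrable:
  assumes "j \<ge> 1"
  shows "integrable M (\<lambda>\<omega>. cantor_fun \<rho> (X j \<omega>))" "integrable M (\<lambda>\<omega>. (cantor_fun \<rho> (X j \<omega>))\<^sup>2)"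
  using assms abs_cantor_fun_le[OF \<rho>]
  by (auto intro!: integrable_const_bound[where B = 1] simp: abs_square_le_1)

text \<open>The lower bound is Chebyshev's inequality read backwards: a deviation of at least 1/2
  has probability at least \<open>\<rho> / 2\<close>, so the variance is at least a quarter of
  that.\<close>

lemma cantor_uniform_variance:
  assumes "j \<ge> 1"
  shows "\<rho> / 8 \<le> variance (\<lambda>\<omega>. cantor_fun \<rho> (X j \<omega>))" "variance (\<lambda>\<omega>. cantor_fun \<rho> (X j \<omega>)) \<le> 1"
proof -
  let ?Z = "\<lambda>\<omega>. cantor_fun \<rho> (X j \<omega>)"
  note [measurable] = uniform_measurable[OF assms] cantor_uniform_measurable[OF assms]
  have le: "prob {\<omega>\<in>space M. X j \<omega> \<le> -1 + \<rho>} = \<rho> / 2" "prob {\<omega>\<in>space M. X j \<omega> \<le> 1 - \<rho>} = 1 - \<rho> / 2"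
    using uniform_distributed_measure[OF unif[OF assms], of "-1 + \<rho>"]
      uniform_distributed_measure[OF unif[OF assms], of "1 - \<rho>"] \<rho> by (auto simp: field_simps)
  have ge: "prob {\<omega>\<in>space M. \<not> X j \<omega> \<le> 1 - \<rho>} = \<rho> / 2"
    using le(2) by (subst prob_neg) auto
  \<comment> \<open>Values at or beyond 1/2 on the side opposite to the sign of the mean are at
    distance at least 1/2 from it.\<close>
  have "\<rho> / 2 \<le> prob {\<omega>\<in>space M. 1/2 \<le> \<bar>?Z \<omega> - expectation ?Z\<bar>}"
  proof (cases "0 \<le> expectation ?Z")
    case True
    have "1/2 \<le> \<bar>?Z \<omega> - expectation ?Z\<bar>" if "X j \<omega> \<le> -1 + \<rho>" for \<omega>
      using cantor_fun_ge_half[OF \<rho>, of "- X j \<omega>"] that True by (simp add: cantor_fun_minus[OF \<rho>])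
    then show ?thesis unfolding le(1)[symmetric] by (intro finite_measure_mono) auto
  next
    case False
    have "1/2 \<le> \<bar>?Z \<omega> - expectation ?Z\<bar>" if "\<not> X j \<omega> \<le> 1 - \<rho>" for \<omega>
      using cantor_fun_ge_half[OF \<rho>, of "X j \<omega>"] that False by simp
    then show ?thesis unfolding ge[symmetric] by (intro finite_measure_mono) auto
  qed
  also have "\<dots> \<le> variance ?Z / (1/2)\<^sup>2"
    using cantor_uniform_integrable[OF assms] by (intro Chebyshev_inequality) auto
  finally show "\<rho> / 8 \<le> variance ?Z" by (simp add: power2_eq_square)
  have "variance ?Z \<le> expectation (\<lambda>\<omega>. (?Z \<omega>)\<^sup>2)"
    using cantor_uniform_integrable[OF assms] by (simp add: variance_eq)
  also have "\<dots> \<le> expectation (\<lambda>\<omega>. 1)"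
    using cantor_uniform_integrable[OF assms] abs_cantor_fun_le[OF \<rho>]
    by (intro integral_mono) (auto simp: abs_square_le_1)
  finally show "variance ?Z \<le> 1" by (simp add: prob_space)
qed

text \<open>The lower bound will turn powers of the standard deviation into powers of
  \<open>n\<close>; the upper bound feeds Chebyshev's inequality for the sum.\<close>

lemma cantor_sum_variance:
  fixes n :: nat
  defines "S \<equiv> \<lambda>\<omega>. \<Sum>j=1..n. cantor_fun \<rho> (X j \<omega>)"
  shows "integrable M (\<lambda>\<omega>. (S \<omega>)\<^sup>2)" "n * (\<rho> / 8) \<le> variance S" "variance S \<le> n"
proof -
  have "indep_vars (\<lambda>_. borel) (\<lambda>j \<omega>. cantor_fun \<rho> (X j \<omega>)) {1..}"
    using indep by (rule indep_vars_compose2) (use cantor_fun_measurable[OF \<rho>] in simp)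
  then have "indep_vars (\<lambda>_. borel) (\<lambda>j \<omega>. cantor_fun \<rho> (X j \<omega>)) {1..n}"
    by (rule indep_vars_subset) auto
  from indep_vars_sum_square_integrable[OF _ this] cantor_uniform_integrable
  have *: "integrable M (\<lambda>\<omega>. (S \<omega>)\<^sup>2)"
    "variance S = (\<Sum>j=1..n. variance (\<lambda>\<omega>. cantor_fun \<rho> (X j \<omega>)))"
    by (auto simp: S_def)
  show "integrable M (\<lambda>\<omega>. (S \<omega>)\<^sup>2)" by fact
  show "n * (\<rho> / 8) \<le> variance S"
    using sum_mono[of "{1..n}" "\<lambda>_. \<rho> / 8"] cantor_uniform_variance(1) by (simp add: *(2))
  show "variance S \<le> n"
  proof -
    have "(\<Sum>j=1..n. variance (\<lambda>\<omega>. cantor_fun \<rho> (X j \<omega>))) \<le> (\<Sum>j=1..n. 1)"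
      by (intro sum_mono cantor_uniform_variance(2)) simp
    then show ?thesis by (simp add: *(2))
  qed
qed

text \<open>Union bound over the cover: at most \<open>2^k\<close> intervals of length
  \<open>2 * \<rho>^k\<close>, each of probability at most \<open>\<rho>^k\<close>.\<close>

lemma cantor_uniform_nonlattice:
  assumes "j \<ge> 1"
  shows "prob {\<omega>\<in>space M. 2 ^ k * cantor_fun \<rho> (X j \<omega>) \<notin> \<int>} \<le> (2 * \<rho>) ^ k"
proof -
  note [measurable] = uniform_measurable[OF assms]
  obtain C where C: "finite C" "card C \<le> 2 ^ k"
    "{x. 2 ^ k * cantor_fun \<rho> x \<notin> \<int>} \<subseteq> (\<Union>c\<in>C. {c - \<rho> ^ k..c + \<rho> ^ k})"
    using cantor_fun_nonlattice_cover[OF \<rho>] by blast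
  have "prob {\<omega>\<in>space M. 2 ^ k * cantor_fun \<rho> (X j \<omega>) \<notin> \<int>}
      \<le> prob (\<Union>c\<in>C. {\<omega>\<in>space M. X j \<omega> \<in> {c - \<rho> ^ k..c + \<rho> ^ k}})"
  proof (rule finite_measure_mono)
    show "{\<omega>\<in>space M. 2 ^ k * cantor_fun \<rho> (X j \<omega>) \<notin> \<int>}
        \<subseteq> (\<Union>c\<in>C. {\<omega>\<in>space M. X j \<omega> \<in> {c - \<rho> ^ k..c + \<rho> ^ k}})"
      using C(3) by blast
  qed (use C(1) in auto)
  also have "\<dots> \<le> (\<Sum>c\<in>C. prob {\<omega>\<in>space M. X j \<omega> \<in> {c - \<rho> ^ k..c + \<rho> ^ k}})"
    using C(1) by (intro finite_measure_subadditive_finite) auto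
  also have "\<dots> \<le> (\<Sum>c\<in>C. \<rho> ^ k)"
  proof (rule sum_mono)
    fix c
    have "c - \<rho> ^ k \<le> c + \<rho> ^ k" using \<rho> by simp
    from prob_uniform_Icc_le[OF unif[OF assms] this]
    show "prob {\<omega>\<in>space M. X j \<omega> \<in> {c - \<rho> ^ k..c + \<rho> ^ k}} \<le> \<rho> ^ k" by simp
  qed
  also have "\<dots> \<le> 2 ^ k * \<rho> ^ k"
  proof -
    have "real (card C) \<le> 2 ^ k" using C(2) by (metis of_nat_le_iff of_nat_numeral of_nat_power)
    then show ?thesis using \<rho> by simp
  qed
  finally show ?thesis by (simp add: power_mult_distrib)
qed

lemma cantor_sum_atom:
  fixes n :: nat
  assumes "n \<ge> 1" "n * (2 * \<rho>) ^ k \<le> 1/2"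
  shows "\<exists>a. 1 / (20 * sqrt n * 2 ^ k) \<le> prob {\<omega>\<in>space M. (\<Sum>j=1..n. cantor_fun \<rho> (X j \<omega>)) = a}"
proof -
  define S where "S = (\<lambda>\<omega>. \<Sum>j=1..n. cantor_fun \<rho> (X j \<omega>))"
  have S[measurable]: "random_variable borel S" unfolding S_def by simp
  let ?bad = "\<lambda>j. {\<omega>\<in>space M. 2 ^ k * cantor_fun \<rho> (X j \<omega>) \<notin> \<int>}"
  let ?far = "{\<omega>\<in>space M. 2 * sqrt n \<le> \<bar>S \<omega> - expectation S\<bar>}"
  let ?good = "{\<omega>\<in>space M. 2 ^ k * S \<omega> \<in> \<int> \<and> \<bar>S \<omega> - expectation S\<bar> \<le> 2 * sqrt n}"
  have [measurable]: "\<int> \<in> sets (borel :: real measure)" by (rule borel_closed[OF closed_Ints])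
  have bad_meas: "?bad j \<in> events" if "j \<in> {1..n}" for j
  proof -
    have [measurable]: "random_variable borel (\<lambda>\<omega>. cantor_fun \<rho> (X j \<omega>))"
      using that by (intro cantor_uniform_measurable) simp
    show ?thesis by measurable
  qed
  have good_meas: "?good \<in> events" by measurable
  have "prob (\<Union>j\<in>{1..n}. ?bad j) \<le> (\<Sum>j\<in>{1..n}. prob (?bad j))"
    using bad_meas by (intro finite_measure_subadditive_finite) auto
  also have "\<dots> \<le> (\<Sum>j\<in>{1..n}. (2 * \<rho>) ^ k)"
    using cantor_uniform_nonlattice by (intro sum_mono) auto
  finally have bad: "prob (\<Union>j\<in>{1..n}. ?bad j) \<le> 1/2" using assms(2) by simp
  have "prob ?far \<le> variance S / (2 * sqrt n)\<^sup>2"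
    using cantor_sum_variance(1)[of n] assms(1) by (intro Chebyshev_inequality) (auto simp: S_def)
  also have "\<dots> \<le> n / (2 * sqrt n)\<^sup>2"
    using cantor_sum_variance(3)[of n] by (intro divide_right_mono) (auto simp: S_def)
  also have "\<dots> = 1/4" using assms(1) by (simp add: power_mult_distrib)
  finally have far: "prob ?far \<le> 1/4" .
  \<comment> \<open>If every summand is in the lattice, so is the sum. The exceptional events cost
    at most 1/2 and 1/4, which leaves 1/4 for the good event.\<close>
  have "space M \<subseteq> ?good \<union> ((\<Union>j\<in>{1..n}. ?bad j) \<union> ?far)"
  proof
    fix \<omega> assume \<omega>: "\<omega> \<in> space M"
    have "2 ^ k * S \<omega> \<in> \<int>" if "\<omega> \<notin> (\<Union>j\<in>{1..n}. ?bad j)"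
      using that \<omega> by (auto simp: S_def sum_distrib_left intro!: Ints_sum)
    then show "\<omega> \<in> ?good \<union> ((\<Union>j\<in>{1..n}. ?bad j) \<union> ?far)"
      using \<omega> by (cases "\<omega> \<in> (\<Union>j\<in>{1..n}. ?bad j)") auto
  qed
  then have "1 \<le> prob (?good \<union> ((\<Union>j\<in>{1..n}. ?bad j) \<union> ?far))"
    using bad_meas unfolding prob_space[symmetric] by (intro finite_measure_mono) auto
  also have "\<dots> \<le> prob ?good + prob ((\<Union>j\<in>{1..n}. ?bad j) \<union> ?far)"
    using bad_meas by (intro measure_Un_le) auto
  also have "prob ((\<Union>j\<in>{1..n}. ?bad j) \<union> ?far) \<le> prob (\<Union>j\<in>{1..n}. ?bad j) + prob ?far"
    using bad_meas by (intro measure_Un_le) auto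
  finally have good: "1/4 \<le> prob ?good" using bad far by simp
  obtain a where a: "(1/4) / (2 * (2 * sqrt n) * 2 ^ k + 1) \<le> prob {\<omega>\<in>space M. S \<omega> = a}"
    using lattice_atom[OF S _ _ _ good] by auto
  \<comment> \<open>Absorbs the additive 1 of the pigeonhole count: 4 times (4 + 1) gives the
    constant 20.\<close>
  have "1 * 1 \<le> sqrt n * 2 ^ k" using assms(1) by (intro mult_mono) auto
  then have "4 * (2 * (2 * sqrt n) * 2 ^ k + 1) \<le> 20 * sqrt n * 2 ^ k" by simp
  then have "1 / (20 * sqrt n * 2 ^ k) \<le> 1 / (4 * (2 * (2 * sqrt n) * 2 ^ k + 1))"
    by (intro divide_left_mono) (auto intro!: mult_pos_pos add_nonneg_pos)
  also have "\<dots> \<le> prob {\<omega>\<in>space M. S \<omega> = a}" using a by simp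
  finally show ?thesis unfolding S_def by blast
qed

text \<open>Eventually the error is at most the \<open>r\<close>-th inverse power of the standard
  deviation, yet at least half the atom; the constant 40 is twice the 20 of the atom bound. The
  threshold \<open>N\<close> is independent of \<open>k\<close>, so \<open>k\<close> can later grow
  with \<open>n\<close>.\<close>

lemma cantor_sum_edgeworth_bound:
  assumes "admits_edgeworth_expansion M (\<lambda>n \<omega>. \<Sum>j=1..n. cantor_fun \<rho> (X j \<omega>)) r"
  shows "\<exists>N. \<forall>n\<ge>N. \<forall>k. 1 \<le> n \<longrightarrow> real n * (2 * \<rho>) ^ k \<le> 1/2 \<longrightarrow>
    sqrt (real n * (\<rho> / 8)) ^ r \<le> 40 * sqrt (real n) * 2 ^ k"
proof -
  define S where "S = (\<lambda>n \<omega>. \<Sum>j=1..n. cantor_fun \<rho> (X j \<omega>))"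
  define D where "D = (\<lambda>n P. SUP t. \<bar>prob {\<omega>\<in>space M. standardized M (S n) \<omega> \<le> t}
      - cdf std_normal_distribution t
      - (\<Sum>j=1..r. (1 / std_dev M (S n) ^ j) * poly (P j n) t * std_normal_density t)\<bar>)"
  obtain P :: "nat \<Rightarrow> nat \<Rightarrow> real poly" where "(\<lambda>n. D n P) \<in> o(\<lambda>n. 1 / std_dev M (S n) ^ r)"
    using assms unfolding admits_edgeworth_expansion_def D_def S_def by blast
  then have "eventually (\<lambda>n. norm (D n P) \<le> 1 * norm (1 / std_dev M (S n) ^ r)) sequentially"
    by (rule landau_o.smallD) simp
  then obtain N where N: "\<And>n. n \<ge> N \<Longrightarrow> \<bar>D n P\<bar> \<le> \<bar>1 / std_dev M (S n) ^ r\<bar>"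
    by (auto simp: eventually_sequentially)
  have "sqrt (n * (\<rho> / 8)) ^ r \<le> 40 * sqrt n * 2 ^ k"
    if n: "N \<le> n" "1 \<le> n" "n * (2 * \<rho>) ^ k \<le> 1/2" for n k
  proof -
    have S[measurable]: "random_variable borel (S n)" unfolding S_def by simp
    \<comment> \<open>For fixed \<open>n\<close> all correction terms merge into one polynomial
      times the normal density, so the approximation \<open>G\<close> is bounded and
      continuous.\<close>
    define p where "p = (\<Sum>j=1..r. smult (1 / std_dev M (S n) ^ j) (P j n))"
    define G where "G = (\<lambda>t. cdf std_normal_distribution t + poly p t * std_normal_density t)"
    obtain B where B: "\<bar>poly p t * std_normal_density t\<bar> \<le> B" for t
      using bounded_poly_mult_std_normal_density by blast
    interpret N: real_distribution std_normal_distribution by (rule real_dist_normal_dist)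
    have "\<bar>cdf std_normal_distribution t\<bar> \<le> 1" for t
      using N.cdf_nonneg[of t] N.cdf_bounded_prob[of t] by simp
    then have G_bound: "\<bar>G t\<bar> \<le> 1 + B" for t
      unfolding G_def by (intro order.trans[OF abs_triangle_ineq] add_mono B)
    have G_cont: "isCont G t" for t
    proof -
      have "isCont std_normal_density t"
        unfolding std_normal_density_def by (intro continuous_intros) auto
      then show ?thesis
        unfolding G_def by (intro continuous_intros isCont_cdf_std_normal)
    qed
    have D_eq: "D n P = (SUP t. \<bar>prob {\<omega>\<in>space M. standardized M (S n) \<omega> \<le> t} - G t\<bar>)"
      by (simp add: D_def G_def p_def poly_sum sum_distrib_right diff_diff_eq)
    obtain a where a: "1 / (20 * sqrt n * 2 ^ k) \<le> prob {\<omega>\<in>space M. S n \<omega> = a}"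
      using cantor_sum_atom[OF n(2,3)] by (auto simp: S_def)
    define b where "b = (a - expectation (S n)) / std_dev M (S n)"
    have std: "random_variable borel (standardized M (S n))"
      unfolding standardized_def[abs_def] by simp
    note a
    also have "prob {\<omega>\<in>space M. S n \<omega> = a} \<le> prob {\<omega>\<in>space M. standardized M (S n) \<omega> = b}"
      using std by (intro finite_measure_mono) (auto simp: standardized_def b_def)
    also have "\<dots> \<le> 2 * D n P"
      unfolding D_eq using std G_cont G_bound by (rule prob_eq_le_2_SUP_cdf_diff)
    also have "\<dots> \<le> 2 * \<bar>1 / std_dev M (S n) ^ r\<bar>"
      using N[OF n(1)] by simp
    finally have le: "1 / (20 * sqrt n * 2 ^ k) \<le> 2 * \<bar>1 / std_dev M (S n) ^ r\<bar>" .
    have std_ge: "sqrt (n * (\<rho> / 8)) \<le> std_dev M (S n)"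
      using cantor_sum_variance(2)[of n] unfolding std_dev_def S_def by simp
    moreover have pos: "0 < sqrt (n * (\<rho> / 8))" using n(2) \<rho> by simp
    ultimately have "0 < std_dev M (S n)" by (rule less_le_trans[rotated])
    then have pow_pos: "0 < std_dev M (S n) ^ r" by (rule zero_less_power)
    have pow_le: "sqrt (n * (\<rho> / 8)) ^ r \<le> std_dev M (S n) ^ r"
      using std_ge less_imp_le[OF pos] by (rule power_mono)
    have "0 < 20 * sqrt n * 2 ^ k" using n(2) by simp
    then have "std_dev M (S n) ^ r \<le> 40 * sqrt n * 2 ^ k"
      using le pow_pos by (simp add: divide_simps mult.assoc)
    then show ?thesis using pow_le by simp
  qed
  then show ?thesis by blast
qed

end

end

section \<open>Choice of the contraction ratio and comparison of growth rates\<close>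

theorem theorem7:
  fixes M :: "'a measure" and X :: "nat \<Rightarrow> 'a \<Rightarrow> real" and \<alpha> :: real
  assumes "prob_space M"
    and "prob_space.indep_vars M (\<lambda>_. borel) X {1..}"
    and "\<And>n. n \<ge> 1 \<Longrightarrow>
           distributed M lborel (X n) (\<lambda>x. indicator {-1..1} x / measure lborel {-1..1::real})"
    and "0 < \<alpha>" and "\<alpha> < 1"
  shows "\<exists>f :: real \<Rightarrow> real.
           f \<in> borel_measurable borel \<and>
           mono_on {-1..1} f \<and>
           (\<forall>x\<in>{-1..1}. f (- x) = - f x) \<and>
           holder_on \<alpha> {-1..1} f \<and>
           f ` {-1..1} = {-1..1} \<and>
           (\<forall>r::nat. real r > (1 + \<alpha>) / (1 - \<alpha>) \<longrightarrow>
              \<not> admits_edgeworth_expansion M (\<lambda>n \<omega>. \<Sum>j=1..n. f (X j \<omega>)) r)"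
proof -
  interpret prob_space M by fact
  define \<rho> :: real where "\<rho> = 2 powr (- 1 / \<alpha>)"
  have "\<rho> < 2 powr (-1)"
    unfolding \<rho>_def using assms(4,5) by (intro powr_less_mono) (auto simp: field_simps)
  then have \<rho>: "0 < \<rho>" "\<rho> < 1/2" by (simp_all add: \<rho>_def powr_minus)
  have dim: "\<rho> powr \<alpha> = 1/2"
    unfolding \<rho>_def powr_powr using assms(4) by (simp add: powr_minus)
  have no_expansion: "\<not> admits_edgeworth_expansion M (\<lambda>n \<omega>. \<Sum>j=1..n. cantor_fun \<rho> (X j \<omega>)) r"
    if r: "real r > (1 + \<alpha>) / (1 - \<alpha>)" for r
  proof
    assume "admits_edgeworth_expansion M (\<lambda>n \<omega>. \<Sum>j=1..n. cantor_fun \<rho> (X j \<omega>)) r"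
    then obtain N :: nat where N: "\<And>n k. n \<ge> N \<Longrightarrow> 1 \<le> n \<Longrightarrow> n * (2 * \<rho>) ^ k \<le> 1/2 \<Longrightarrow>
        sqrt (n * (\<rho> / 8)) ^ r \<le> 40 * sqrt n * 2 ^ k"
      using cantor_sum_edgeworth_bound[OF assms(2,3) \<rho>] by blast
    \<comment> \<open>With \<open>n\<close> of order \<open>b^k\<close>, dividing the Edgeworth
      bound by \<open>sqrt n\<close> leaves \<open>n powr e\<close> at most a constant times
      \<open>2^k\<close>; \<open>w\<close> is the ratio of the growth rates of the two sides in
      \<open>k\<close>.\<close>
    define b where "b = 1 / (2 * \<rho>)"
    define e where "e = (real r - 1) / 2"
    define w where "w = b powr e / 2"
    have b: "b > 1" using \<rho> by (simp add: b_def)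
    have "2 * \<rho> = 2 powr (1 - 1 / \<alpha>)"
      by (simp add: \<rho>_def powr_diff powr_minus divide_inverse)
    then have b_powr: "b = 2 powr (1 / \<alpha> - 1)"
      by (simp add: b_def powr_minus_divide[symmetric])
    \<comment> \<open>This is the hypothesis on \<open>r\<close> rearranged: the critical order is
      exactly where \<open>b powr e\<close> equals 2.\<close>
    have "1 < (1 / \<alpha> - 1) * e"
      using r assms(4,5) by (simp add: e_def field_simps)
    then have "2 powr 1 < b powr e"
      unfolding b_powr powr_powr by (intro powr_less_mono) auto
    then have w: "w > 1" by (simp add: w_def)
    have "0 < e"
    proof -
      have "1 < (1 + \<alpha>) / (1 - \<alpha>)" using assms(4,5) by (simp add: field_simps)
      then show ?thesis using r by (simp add: e_def)
    qed
    \<comment> \<open>The factor \<open>4 powr e\<close> pays for replacing \<open>n\<close> by its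
      lower bound \<open>b^k / 4\<close>.\<close>
    define K where "K = 40 * 4 powr e / sqrt (\<rho> / 8) ^ r"
    have bound: "w ^ k \<le> K" if k: "4 + 4 * real N \<le> b ^ k" for k
    proof -
      \<comment> \<open>The largest \<open>n\<close> allowed by the condition
        \<open>n * (2 * \<rho>)^k \<le> 1/2\<close>. The threshold on \<open>b^k\<close> ensures
        that rounding down loses at most half and that \<open>n\<close> is at least \<open>N\<close>
        and 1.\<close>
      define n where "n = nat \<lfloor>b ^ k / 2\<rfloor>"
      have n_real: "real n = of_int \<lfloor>b ^ k / 2\<rfloor>"
        using b by (simp add: n_def)
      have n_le: "real n \<le> b ^ k / 2" unfolding n_real by (rule of_int_floor_le)
      have "b ^ k / 2 < real n + 1" unfolding n_real by (rule floor_correct[THEN conjunct2, simplified])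
      then have n_ge: "b ^ k / 4 \<le> real n" "1 \<le> n" "N \<le> n"
        using k by linarith+
      have "n * (2 * \<rho>) ^ k \<le> b ^ k / 2 * (2 * \<rho>) ^ k"
        using n_le \<rho> by (intro mult_right_mono) auto
      also have "\<dots> = 1/2"
        using \<rho> by (simp add: b_def power_divide)
      finally have "sqrt (n * (\<rho> / 8)) ^ r \<le> 40 * sqrt n * 2 ^ k"
        using n_ge by (intro N)
      then have le: "sqrt n ^ r * sqrt (\<rho> / 8) ^ r \<le> 40 * sqrt n * 2 ^ k"
        by (simp only: real_sqrt_mult power_mult_distrib)
      have "sqrt n ^ r = n powr (r / 2)"
        using n_ge(2) by (simp add: powr_half_sqrt[symmetric] powr_power)
      also have "\<dots> = n powr e * sqrt n"
      proof -
        have "real r / 2 = e + 1 / 2" by (simp add: e_def field_simps)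
        then show ?thesis by (simp only: powr_add powr_half_sqrt of_nat_0_le_iff)
      qed
      finally have "(n powr e * sqrt (\<rho> / 8) ^ r) * sqrt n \<le> (40 * 2 ^ k) * sqrt n"
        using le by (simp add: mult_ac)
      then have "n powr e * sqrt (\<rho> / 8) ^ r \<le> 40 * 2 ^ k"
        using n_ge(2) by (subst (asm) mult_le_cancel_right_pos) auto
      then have "n powr e \<le> 40 * 2 ^ k / sqrt (\<rho> / 8) ^ r"
        using \<rho> by (simp add: pos_le_divide_eq)
      moreover have "(b ^ k / 4) powr e \<le> n powr e"
        using n_ge(1) b \<open>0 < e\<close> by (intro powr_mono2) auto
      moreover have "(b ^ k / 4) powr e = (w * 2) ^ k / 4 powr e"
        using b by (simp add: w_def powr_divide powr_realpow[symmetric] powr_powr mult.commute)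
      ultimately have "(w * 2) ^ k / 4 powr e \<le> 40 * 2 ^ k / sqrt (\<rho> / 8) ^ r" by simp
      then have "w ^ k * 2 ^ k \<le> K * 2 ^ k"
        by (simp add: K_def power_mult_distrib pos_divide_le_eq mult_ac)
      then show ?thesis by simp
    qed
    have unbounded: "eventually (\<lambda>k. C \<le> x ^ k) sequentially" if "x > 1" for x C :: real
    proof -
      have "filterlim (\<lambda>k. norm (x ^ k)) at_top sequentially"
        using that by (intro filterlim_at_infinity_imp_norm_at_top filterlim_realpow_sequentially_gt1) simp
      then show ?thesis using that by (simp add: filterlim_at_top norm_power)
    qed
    \<comment> \<open>For large \<open>k\<close> the bound \<open>w^k \<le> K\<close> applies
      although \<open>w^k\<close> already exceeds \<open>K\<close>.\<close>
    from unbounded[OF b, of "4 + 4 * real N"] unbounded[OF w, of "K + 1"]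
    have "eventually (\<lambda>k. False) sequentially"
    proof eventually_elim
      case (elim k)
      then show ?case using bound[of k] by simp
    qed
    then show False by simp
  qed
  show ?thesis
  proof (intro exI[of _ "cantor_fun \<rho>"] conjI allI impI)
    show "cantor_fun \<rho> \<in> borel_measurable borel"
      using \<rho> by (rule cantor_fun_measurable)
    show "mono_on {-1..1} (cantor_fun \<rho>)"
      by (intro mono_onI cantor_fun_mono \<rho>)
    show "\<forall>x\<in>{-1..1}. cantor_fun \<rho> (- x) = - cantor_fun \<rho> x"
      by (intro ballI cantor_fun_minus \<rho>)
    show "holder_on \<alpha> {-1..1} (cantor_fun \<rho>)"
      unfolding holder_on_def using cantor_fun_holder[OF \<rho> dim] by blast
    show "cantor_fun \<rho> ` {-1..1} = {-1..1}" using \<rho> by (rule cantor_fun_image)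
  qed (rule no_expansion)
qed

end
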